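(* Let $\{\{X_s:s\in\omega^{n+1}\}:n\in\omega\}$ be a family such that for every $n\in\omega$, $\{X_s:s\in\omega^{n+1}\}$ is a partition of $\omega$ into infinite sets, and such that $\bigcap_{i\in F}X_{s_i}$ is infinite for every finite $F\subseteq\omega$ and every choice of $s_i\in\omega^{i+1}$, $i\in F$. Let $\mathrm{Fin}'_\omega$ be the ideal on $\omega$ defined from this family as in the context. Then $\mathrm{Fin}'_\omega$ is a $\mathbf{\Sigma^0_\omega}$ ideal and $\mathrm{rk}(\mathrm{Fin}'_\omega)=\omega$.
   Context: An ideal on a countably infinite set $X$ is a family $\mathcal{I}\subseteq\mathcal{P}(X)$ closed under subsets and finite unions, with $X\notin\mathcal{I}$ and containing all finite subsets of $X$; write $\mathrm{dom}(\mathcal{I})=X$ and $\mathcal{I}^\star=\{X\setminus A:A\in\mathcal{I}\}$. $\mathcal{P}(X)$ is identified with $2^X$ (product topology), so Borel classes of families of subsets make sense. $\mathrm{Fin}$ is the ideal of finite subsets of $\omega$. For $n\ge1$ the ideal $\mathrm{Fin}^n$ on $\omega^n$ is defined by $\mathrm{Fin}^1=\mathrm{Fin}$ and: $A\subseteq\omega^{n+1}$ is in $\mathrm{Fin}^{n+1}$ iff $\{i\in\omega:\{x\in\omega^n:(i,x)\in A\}\notin\mathrm{Fin}^n\}$ is finite. For $n\in\omega$, $\mathrm{Fin}^{n+2}(\{X_s:s\in\omega^{n+1}\})$ is the family of all $A\subseteq\omega$ such that $\{s\in\omega^{n+1}: A\cap X_s \text{ is infinite}\}\in\mathrm{Fin}^{n+1}$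 (equivalently, the isomorphic copy of $\mathrm{Fin}^{n+2}$ on $\omega$ induced by any bijection $\sigma:\omega^{n+2}\to\omega$ with $\sigma[\{s\}\times\omega]=X_s$ for all $s\in\omega^{n+1}$). $\mathrm{Fin}'_\omega$ is the ideal on $\omega$ generated by $\bigcup_{n\in\omega}\mathrm{Fin}^{n+2}(\{X_s:s\in\omega^{n+1}\})$, i.e. the sets contained in a finite union of members of this family. For an analytic ideal $\mathcal{I}$, its rank $\mathrm{rk}(\mathcal{I})$ is the least $\alpha<\omega_1$ such that there is $\mathcal{S}\in\mathbf{\Sigma^0_{1+\alpha}}$ with $\mathcal{I}\subseteq\mathcal{S}$ and $\mathcal{I}^\star\cap\mathcal{S}=\emptyset$. *)

theory Defs
  imports "HOL-Analysis.Analysis"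
begin

section \<open>Countable ordinals\<close>

text \<open>The elements of the cardinal successor of \<^const>\<open>natLeq\<close>, i.e. of a well-order of type
  \<open>\<omega>\<^sub>1\<close>, represent the ordinals below \<open>\<omega>\<^sub>1\<close>.  The lemmas \<open>countable_lessThan_omega1\<close>,
  \<open>uncountable_omega1\<close> and \<open>ex_greater_omega1\<close> below characterize this order type.\<close>

typedef omega1 = "Field (cardSuc natLeq)"
  using Field_cardSuc_not_empty[OF natLeq_Card_order] by auto

lemma wo_rel_omega1: "wo_rel (cardSuc natLeq)"
  by (simp add: wo_rel_def cardSuc_Well_order natLeq_Card_order)

instantiation omega1 :: wellorder
begin

definition less_eq_omega1 :: "omega1 \<Rightarrow> omega1 \<Rightarrow> bool" where
  "\<alpha> \<le> \<beta> \<longleftrightarrow> (Rep_omega1 \<alpha>, Rep_omega1 \<beta>) \<in> cardSuc natLeq"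

definition less_omega1 :: "omega1 \<Rightarrow> omega1 \<Rightarrow> bool" where
  "\<alpha> < \<beta> \<longleftrightarrow> \<alpha> \<le> \<beta> \<and> \<not> \<beta> \<le> (\<alpha> :: omega1)"

instance
proof
  fix x y z :: omega1
  show "x < y \<longleftrightarrow> x \<le> y \<and> \<not> y \<le> x" by (rule less_omega1_def)
  show "x \<le> x"
    unfolding less_eq_omega1_def
    using wo_rel.REFL[OF wo_rel_omega1] Rep_omega1 by (auto simp: refl_on_def)
  show "x \<le> z" if "x \<le> y" "y \<le> z"
    using that wo_rel.TRANS[OF wo_rel_omega1] unfolding less_eq_omega1_def by (rule transD[rotated])
  show "x = y" if "x \<le> y" "y \<le> x"
    using that wo_rel.ANTISYM[OF wo_rel_omega1] unfolding less_eq_omega1_def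
    by (metis Rep_omega1_inject antisymD)
  show "x \<le> y \<or> y \<le> x"
    unfolding less_eq_omega1_def
    using wo_rel.TOTALS[OF wo_rel_omega1] Rep_omega1 by blast
next
  fix P :: "omega1 \<Rightarrow> bool" and a
  assume step: "\<And>x. (\<And>y. y < x \<Longrightarrow> P y) \<Longrightarrow> P x"
  have "wf (inv_image (cardSuc natLeq - Id) Rep_omega1)"
    using wo_rel.WF[OF wo_rel_omega1] by (rule wf_inv_image)
  moreover have "{(x, y). x < y} \<subseteq> inv_image (cardSuc natLeq - Id) Rep_omega1"
    by (auto simp: less_omega1_def less_eq_omega1_def inv_image_def)
  ultimately have "wf {(x :: omega1, y). x < y}"
    by (rule wf_subset)
  then show "P a"
    by (induction a rule: wf_induct_rule) (use step in auto)
qed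

end

lemma countable_lessThan_omega1:
  includes cardinal_syntax
  shows "countable {..<\<alpha> :: omega1}"
proof -
  let ?r = "cardSuc natLeq" and ?a = "Rep_omega1 \<alpha>"
  have "|underS ?r ?a| <o ?r"
    using card_of_underS[OF cardSuc_Card_order[OF natLeq_Card_order]] Rep_omega1 by blast
  then have "|underS ?r ?a| \<le>o natLeq"
    using cardSuc_ordLeq_ordLess[OF natLeq_Card_order card_of_Card_order] by blast
  then have "|underS ?r ?a| \<le>o |UNIV :: nat set|"
    using card_of_nat ordIso_symmetric ordLeq_ordIso_trans by blast
  then have "countable (underS ?r ?a)"
    by (auto simp: card_of_ordLeq[symmetric] countable_def)
  moreover have "Rep_omega1 ` {..<\<alpha>} \<subseteq> underS ?r ?a"
    by (auto simp: underS_def less_omega1_def less_eq_omega1_def)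
  ultimately have "countable (Rep_omega1 ` {..<\<alpha>})"
    by (rule countable_subset[rotated])
  then show ?thesis
    using countable_image_inj_on[of Rep_omega1 "{..<\<alpha>}"] by (simp add: inj_on_def Rep_omega1_inject)
qed

lemma uncountable_omega1:
  includes cardinal_syntax
  shows "uncountable (UNIV :: omega1 set)"
proof
  assume "countable (UNIV :: omega1 set)"
  then have "countable (range Rep_omega1)" by (rule countable_image)
  then have "countable (Field (cardSuc natLeq))"
    using type_definition.Rep_range[OF type_definition_omega1] by metis
  then have "|Field (cardSuc natLeq)| \<le>o |UNIV :: nat set|"
    by (auto simp: card_of_ordLeq[symmetric] countable_def)
  then have "cardSuc natLeq \<le>o natLeq"
    by (meson card_of_Field_ordIso cardSuc_Card_order natLeq_Card_order card_of_nat
        ordIso_symmetric ordIso_ordLeq_trans ordLeq_ordIso_trans)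
  with cardSuc_greater[OF natLeq_Card_order] show False
    using not_ordLess_ordLeq by blast
qed

lemma ex_greater_omega1:
  assumes "countable (A :: omega1 set)"
  shows "\<exists>\<gamma>. \<forall>\<alpha>\<in>A. \<alpha> < \<gamma>"
proof (rule ccontr)
  assume *: "\<not> ?thesis"
  have "UNIV = (\<Union>\<alpha>\<in>A. insert \<alpha> {..<\<alpha>})"
  proof (intro equalityI subsetI)
    fix \<gamma> :: omega1
    from * obtain \<alpha> where "\<alpha> \<in> A" "\<gamma> \<le> \<alpha>"
      by (meson not_less)
    then show "\<gamma> \<in> (\<Union>\<alpha>\<in>A. insert \<alpha> {..<\<alpha>})"
      by (auto simp: order_le_less)
  qed auto
  moreover have "countable (\<Union>\<alpha>\<in>A. insert \<alpha> {..<\<alpha>})"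
    using assms by (intro countable_UN countable_insert countable_lessThan_omega1)
  ultimately show False
    using uncountable_omega1 by simp
qed

instantiation omega1 :: "{zero, one, plus}"
begin

definition zero_omega1 :: omega1 where
  "zero_omega1 = (LEAST \<alpha>. True)"

definition one_omega1 :: omega1 where
  "one_omega1 = (LEAST \<alpha>. 0 < \<alpha>)"

text \<open>Ordinal addition: \<open>\<alpha> + \<beta>\<close> is the least ordinal that is \<open>\<ge> \<alpha>\<close> and exceeds all \<open>\<alpha> + \<delta>\<close>
  with \<open>\<delta> < \<beta>\<close>.\<close>

function plus_omega1 :: "omega1 \<Rightarrow> omega1 \<Rightarrow> omega1" where
  "plus_omega1 \<alpha> \<beta> = (LEAST \<gamma>. \<alpha> \<le> \<gamma> \<and> (\<forall>\<delta>\<in>{..<\<beta>}. plus_omega1 \<alpha> \<delta> < \<gamma>))"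
  by auto
termination
  by (relation "inv_image {(x, y). x < y} snd") (auto intro: wf_inv_image wf)

instance ..

end

declare plus_omega1.simps [simp del]

text \<open>The ordinal \<open>\<omega>\<close>, as the least nonzero limit ordinal.\<close>

definition omega :: omega1 where
  "omega = (LEAST \<eta>. 0 < \<eta> \<and> (\<forall>\<beta><\<eta>. \<exists>\<gamma>. \<beta> < \<gamma> \<and> \<gamma> < \<eta>))"


section \<open>Borel classes and the rank of an ideal\<close>

text \<open>\<open>Sigma0 \<alpha> S\<close> says that \<open>S\<close> belongs to \<open>\<Sigma>\<^sup>0\<^sub>\<alpha>\<close>.  The hierarchy starts at level 1, so no set
  satisfies \<open>Sigma0 0\<close>.\<close>

inductive Sigma0 :: "omega1 \<Rightarrow> 'a::topological_space set \<Rightarrow> bool" where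
  open_set: "open U \<Longrightarrow> Sigma0 1 U"
| countable_Union:
    "1 < \<alpha> \<Longrightarrow> (\<And>n :: nat. \<exists>\<beta>. 1 \<le> \<beta> \<and> \<beta> < \<alpha> \<and> Sigma0 \<beta> (- A n)) \<Longrightarrow> Sigma0 \<alpha> (\<Union>n. A n)"

text \<open>Subsets of \<open>\<omega>\<close> are identified with their characteristic functions in \<^typ>\<open>nat \<Rightarrow> bool\<close>, which
  carries the product topology of the discrete space \<^typ>\<open>bool\<close>.\<close>

definition Sigma0_fam :: "omega1 \<Rightarrow> nat set set set" where
  "Sigma0_fam \<alpha> = {\<S>. Sigma0 \<alpha> ((\<lambda>A n. n \<in> A) ` \<S>)}"

definition ideal_on_nat :: "nat set set \<Rightarrow> bool" where
  "ideal_on_nat \<I> \<longleftrightarrow>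
     (\<forall>A\<in>\<I>. \<forall>B. B \<subseteq> A \<longrightarrow> B \<in> \<I>) \<and> (\<forall>A\<in>\<I>. \<forall>B\<in>\<I>. A \<union> B \<in> \<I>) \<and>
     UNIV \<notin> \<I> \<and> (\<forall>A. finite A \<longrightarrow> A \<in> \<I>)"

definition dual_filter :: "nat set set \<Rightarrow> nat set set" where
  "dual_filter \<I> = {- A | A. A \<in> \<I>}"

text \<open>The rank is meaningful only for families \<open>\<I>\<close> for which some separating set exists, e.g. for
  analytic ideals; otherwise the value is unspecified.\<close>

definition rk :: "nat set set \<Rightarrow> omega1" where
  "rk \<I> = (LEAST \<alpha>. \<exists>\<S>\<in>Sigma0_fam (1 + \<alpha>). \<I> \<subseteq> \<S> \<and> dual_filter \<I> \<inter> \<S> = {})"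


section \<open>The ideals \<open>Fin\<^sup>n\<close> and \<open>Fin'\<^sub>\<omega>\<close>\<close>

text \<open>The set \<open>\<omega>\<^sup>n\<close>, whose elements are represented as lists of length \<open>n\<close>.\<close>

definition seqs :: "nat \<Rightarrow> nat list set" where
  "seqs n = {s. length s = n}"

text \<open>Only the exponents \<open>n \<ge> 1\<close> matter; the value at 0 is a dummy.\<close>

fun Fin_pow :: "nat \<Rightarrow> nat list set set" where
  "Fin_pow 0 = {}"
| "Fin_pow (Suc 0) = {A. A \<subseteq> seqs 1 \<and> finite A}"
| "Fin_pow (Suc (Suc n)) =
     {A. A \<subseteq> seqs (n + 2) \<and> finite {i. {x \<in> seqs (n + 1). i # x \<in> A} \<notin> Fin_pow (Suc n)}}"

text \<open>A family \<open>X\<close> is indexed by all nonempty finite sequences at once, and \<open>Fin_part n X\<close> is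
  \<open>Fin\<^bsup>n+2\<^esup>({X\<^sub>s : s \<in> \<omega>\<^bsup>n+1\<^esup>})\<close>.\<close>

definition Fin_part :: "nat \<Rightarrow> (nat list \<Rightarrow> nat set) \<Rightarrow> nat set set" where
  "Fin_part n X = {A. {s \<in> seqs (n + 1). infinite (A \<inter> X s)} \<in> Fin_pow (n + 1)}"

definition Fin'_omega :: "(nat list \<Rightarrow> nat set) \<Rightarrow> nat set set" where
  "Fin'_omega X = {A. \<exists>\<F>. finite \<F> \<and> \<F> \<subseteq> (\<Union>n. Fin_part n X) \<and> A \<subseteq> \<Union>\<F>}"

text \<open>An indexed partition: disjointness is required for distinct indices, not just for distinct
  values.\<close>

definition partition_into_infinite :: "nat list set \<Rightarrow> (nat list \<Rightarrow> nat set) \<Rightarrow> bool" where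
  "partition_into_infinite S X \<longleftrightarrow>
     disjoint_family_on X S \<and> (\<Union>s\<in>S. X s) = UNIV \<and> (\<forall>s\<in>S. infinite (X s))"

end

theory Submission
  imports Defs
begin

text \<open>Upper bound: \<open>E \<subseteq> \<omega>\<^bsup>n+1\<^esup>\<close> is in \<open>Fin\<^bsup>n+1\<^esup>\<close> iff for some threshold function \<open>f\<close> on finite
  sequences every \<open>s \<in> E\<close> has a coordinate \<open>s\<^sub>l < f (s\<restriction>l)\<close>.  So \<open>A \<in> Fin'\<^sub>\<omega>\<close> iff for some \<open>N\<close> there is
  a function \<open>f\<close> on countably many nodes such that every \<open>x \<in> A\<close> satisfies one of \<open>k = k(N)\<close> conditions
  \<open>v < f q\<close>.  As the conditions are monotone in \<open>f\<close> and \<open>k\<close> does not depend on \<open>x\<close>, the existence of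
  \<open>f\<close> is equivalent to \<open>\<forall>p\<^sub>1 \<exists>a\<^sub>1 \<dots> \<forall>p\<^sub>k \<exists>a\<^sub>k\<close> followed by a closed condition on \<open>A\<close>, which is Borel of
  finite level.

  Lower bound: by induction on \<open>n\<close>, the complement \<open>D\<close> of the diagonal of a universal \<open>\<Sigma>\<^sup>0\<^bsub>n+1\<^esub>\<close> set has a
  continuous map into the subsets of \<open>\<omega>\<^bsup>n+2\<^esup>\<close> that sends \<open>D\<close> into \<open>Fin\<^bsup>n+2\<^esup>\<close> and the complement of
  \<open>D\<close> into the dual filter.  A \<open>\<Sigma>\<^sup>0\<^bsub>n+1\<^esub>\<close> set separating the two would make \<open>D\<close> a \<open>\<Sigma>\<^sup>0\<^bsub>n+1\<^esub>\<close> set.\<close>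

section \<open>Finite ordinals and \<open>\<omega>\<close>\<close>

text \<open>Successors are taken as least strict upper bounds, so order facts follow from
  well-ordering alone and not from ordinal addition.\<close>

primrec fin_ord :: "nat \<Rightarrow> omega1" where
  "fin_ord 0 = 0"
| "fin_ord (Suc n) = (LEAST \<beta>. fin_ord n < \<beta>)"

lemma omega1_zero_le: "0 \<le> (\<alpha> :: omega1)"
  unfolding zero_omega1_def by (rule Least_le) simp

lemma omega1_ex_greater: "\<exists>\<beta>. (\<alpha> :: omega1) < \<beta>"
  using ex_greater_omega1[of "{\<alpha>}"] by auto

lemma fin_ord_less_Suc: "fin_ord n < fin_ord (Suc n)"
  using LeastI_ex[OF omega1_ex_greater] by simp

lemma fin_ord_Suc_le: "fin_ord n < \<beta> \<Longrightarrow> fin_ord (Suc n) \<le> \<beta>"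
  by (simp add: Least_le)

declare fin_ord.simps(2) [simp del]

lemma strict_mono_fin_ord: "strict_mono fin_ord"
  by (simp add: strict_mono_Suc_iff fin_ord_less_Suc)

lemma fin_ord_less_iff [simp]: "fin_ord m < fin_ord n \<longleftrightarrow> m < n"
  by (rule strict_mono_less[OF strict_mono_fin_ord])

lemma fin_ord_le_iff [simp]: "fin_ord m \<le> fin_ord n \<longleftrightarrow> m \<le> n"
  by (rule strict_mono_less_eq[OF strict_mono_fin_ord])

lemma one_eq_fin_ord: "1 = fin_ord (Suc 0)"
  by (simp add: one_omega1_def fin_ord.simps)

text \<open>\<open>omega\<close> is a \<open>LEAST\<close>, so its defining property needs a
  witness: the supremum \<open>?w\<close> of the finite ordinals.\<close>

lemma omega_limit: "0 < omega \<and> (\<forall>\<beta><omega. \<exists>\<gamma>. \<beta> < \<gamma> \<and> \<gamma> < omega)"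
proof -
  let ?w = "LEAST \<eta>. \<forall>n. fin_ord n < \<eta>"
  have "\<exists>\<eta>. \<forall>n. fin_ord n < \<eta>"
    using ex_greater_omega1[of "range fin_ord"] by auto
  then have w: "fin_ord n < ?w" for n
    using LeastI_ex[of "\<lambda>\<eta>. \<forall>n. fin_ord n < \<eta>"] by blast
  have "0 < ?w"
    using w[of 0] by simp
  moreover have "\<exists>\<gamma>. \<beta> < \<gamma> \<and> \<gamma> < ?w" if "\<beta> < ?w" for \<beta>
  proof -
    from not_less_Least[OF that] obtain n where "\<beta> \<le> fin_ord n"
      by (auto simp: not_less)
    then have "\<beta> < fin_ord (Suc n)"
      using fin_ord_less_Suc[of n] by (rule le_less_trans)
    with w show ?thesis
      by blast
  qed
  ultimately show ?thesis
    unfolding omega_def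
    by (rule LeastI[of "\<lambda>\<eta>. 0 < \<eta> \<and> (\<forall>\<beta><\<eta>. \<exists>\<gamma>. \<beta> < \<gamma> \<and> \<gamma> < \<eta>)", OF conjI[OF _ allI[OF impI]]])
qed

lemma fin_ord_less_omega: "fin_ord n < omega"
proof (induction n)
  case (Suc n)
  then obtain \<gamma> where "fin_ord n < \<gamma>" "\<gamma> < omega"
    using omega_limit by blast
  then show ?case
    using fin_ord_Suc_le by (meson le_less_trans)
qed (simp add: omega_limit)

text \<open>By minimality of \<open>omega\<close>, a nonzero \<open>\<beta>\<close> below it is not
  a limit, hence the successor of some \<open>\<delta>\<close>, to which induction applies.\<close>

lemma less_omegaE:
  assumes "\<beta> < omega"
  obtains n where "\<beta> = fin_ord n"
proof -
  from assms have "\<exists>n. \<beta> = fin_ord n"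
  proof (induction \<beta> rule: less_induct)
    case (less \<beta>)
    show ?case
    proof (cases "\<beta> = 0")
      case True
      then have "\<beta> = fin_ord 0" by simp
      then show ?thesis ..
    next
      case False
      then have "0 < \<beta>"
        using omega1_zero_le[of \<beta>] by simp
      moreover have "\<not> (0 < \<beta> \<and> (\<forall>\<delta><\<beta>. \<exists>\<gamma>. \<delta> < \<gamma> \<and> \<gamma> < \<beta>))"
        using less.prems unfolding omega_def by (rule not_less_Least)
      ultimately obtain \<delta> where \<delta>: "\<delta> < \<beta>" "\<And>\<gamma>. \<delta> < \<gamma> \<Longrightarrow> \<beta> \<le> \<gamma>"
        by (meson not_le)
      then obtain n where "\<delta> = fin_ord n"
        using less by (meson less_trans)
      with \<delta> have "\<beta> = fin_ord (Suc n)"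
        by (metis antisym fin_ord_Suc_le fin_ord_less_Suc)
      then show ?thesis ..
    qed
  qed
  with that show ?thesis by blast
qed

lemma less_fin_ordE:
  assumes "\<beta> < fin_ord n"
  obtains m where "\<beta> = fin_ord m" "m < n"
  using assms less_omegaE[of \<beta>] fin_ord_less_omega[of n] by (metis fin_ord_less_iff less_trans)

text \<open>Resolves the shift \<open>1 + \<alpha>\<close> in \<open>rk\<close>: rank
  \<open>fin_ord n\<close> refers to the class at level \<open>fin_ord (Suc n)\<close>.\<close>

lemma one_plus_fin_ord: "1 + fin_ord n = fin_ord (Suc n)"
proof (induction n rule: less_induct)
  case (less n)
  have "1 + fin_ord n = (LEAST \<gamma>. 1 \<le> \<gamma> \<and> (\<forall>\<delta>\<in>{..<fin_ord n}. 1 + \<delta> < \<gamma>))"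
    by (rule plus_omega1.simps)
  also have "\<dots> = fin_ord (Suc n)"
  proof (rule Least_equality)
    show "1 \<le> fin_ord (Suc n) \<and> (\<forall>\<delta>\<in>{..<fin_ord n}. 1 + \<delta> < fin_ord (Suc n))"
    proof (intro conjI ballI)
      show "1 + \<delta> < fin_ord (Suc n)" if "\<delta> \<in> {..<fin_ord n}" for \<delta>
        using that less by (auto elim!: less_fin_ordE)
    qed (simp add: one_eq_fin_ord)
  next
    fix \<gamma> assume \<gamma>: "1 \<le> \<gamma> \<and> (\<forall>\<delta>\<in>{..<fin_ord n}. 1 + \<delta> < \<gamma>)"
    show "fin_ord (Suc n) \<le> \<gamma>"
    proof (cases n)
      case 0
      with \<gamma> show ?thesis by (simp add: one_eq_fin_ord)
    next
      case (Suc m)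
      with \<gamma> have "1 + fin_ord m < \<gamma>"
        by simp
      with Suc show ?thesis
        using less[of m] fin_ord_Suc_le by simp
    qed
  qed
  finally show ?case .
qed

lemma one_plus_omega: "1 + omega = omega"
proof -
  have "1 + omega = (LEAST \<gamma>. 1 \<le> \<gamma> \<and> (\<forall>\<delta>\<in>{..<omega}. 1 + \<delta> < \<gamma>))"
    by (rule plus_omega1.simps)
  also have "\<dots> = omega"
  proof (rule Least_equality)
    show "1 \<le> omega \<and> (\<forall>\<delta>\<in>{..<omega}. 1 + \<delta> < omega)"
    proof (intro conjI ballI)
      show "1 \<le> omega"
        using fin_ord_less_omega[of "Suc 0"] by (simp add: one_eq_fin_ord)
      show "1 + \<delta> < omega" if "\<delta> \<in> {..<omega}" for \<delta>
        using that by (auto simp: one_plus_fin_ord fin_ord_less_omega elim: less_omegaE)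
    qed
  next
    fix \<gamma> assume \<gamma>: "1 \<le> \<gamma> \<and> (\<forall>\<delta>\<in>{..<omega}. 1 + \<delta> < \<gamma>)"
    show "omega \<le> \<gamma>"
    proof (rule ccontr)
      assume "\<not> omega \<le> \<gamma>"
      then obtain n where "\<gamma> = fin_ord n"
        using less_omegaE not_le by metis
      moreover have "1 + fin_ord n < \<gamma>"
        using \<gamma> fin_ord_less_omega by simp
      ultimately show False
        by (simp add: one_plus_fin_ord)
    qed
  qed
  finally show ?thesis .
qed


section \<open>Finite Borel levels\<close>

lemma Sigma0_one_iff: "Sigma0 1 S \<longleftrightarrow> open S"
  by (auto elim: Sigma0.cases intro: Sigma0.open_set)

lemma Sigma0_fin_ord_Union:
  assumes "\<And>k :: nat. Sigma0 (fin_ord (Suc n)) (- A k)"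
  shows "Sigma0 (fin_ord (Suc (Suc n))) (\<Union>k. A k)"
proof (rule Sigma0.countable_Union)
  show "\<exists>\<beta>. 1 \<le> \<beta> \<and> \<beta> < fin_ord (Suc (Suc n)) \<and> Sigma0 \<beta> (- A k)" for k
    using assms by (intro exI[of _ "fin_ord (Suc n)"]) (simp add: one_eq_fin_ord)
qed (simp add: one_eq_fin_ord)

text \<open>The level \<open>m\<close> may vary with \<open>k\<close>: in an arbitrary topological
  space an open set need not be an F_sigma, so lower levels are not merged here.\<close>

lemma Sigma0_fin_ord_SucD:
  fixes S :: "'a::topological_space set"
  assumes "Sigma0 (fin_ord (Suc (Suc n))) S"
  shows "\<exists>A :: nat \<Rightarrow> 'a set.
    S = (\<Union>k. A k) \<and> (\<forall>k. \<exists>m\<le>n. Sigma0 (fin_ord (Suc m)) (- A k))"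
  using assms
proof (cases rule: Sigma0.cases)
  case open_set
  then show ?thesis
    by (simp add: one_eq_fin_ord strict_mono_eq[OF strict_mono_fin_ord])
next
  case (countable_Union A)
  have "\<exists>m\<le>n. Sigma0 (fin_ord (Suc m)) (- A k)" for k
  proof -
    obtain \<beta> where \<beta>: "1 \<le> \<beta>" "\<beta> < fin_ord (Suc (Suc n))" "Sigma0 \<beta> (- A k)"
      using countable_Union by blast
    then obtain m where m: "\<beta> = fin_ord m" "m < Suc (Suc n)"
      by (auto elim: less_fin_ordE)
    with \<beta>(1) obtain m' where "m = Suc m'"
      by (cases m) (auto simp: one_eq_fin_ord simp del: fin_ord.simps)
    with \<beta>(3) m show ?thesis
      by (intro exI[of _ m']) simp
  qed
  with countable_Union(1) show ?thesis
    by blast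
qed

lemma Sigma0_vimage:
  assumes "Sigma0 \<alpha> S" "continuous_on UNIV f"
  shows "Sigma0 \<alpha> (f -` S)"
  using assms(1)
proof (induction rule: Sigma0.induct)
  case (open_set U)
  then show ?case
    using assms(2) by (intro Sigma0.open_set) (simp add: open_vimage)
next
  case (countable_Union \<alpha> A)
  have "Sigma0 \<alpha> (\<Union>n. f -` A n)"
    using countable_Union by (intro Sigma0.countable_Union) (auto simp: vimage_Compl)
  then show ?case
    by (simp add: vimage_UN)
qed


section \<open>The membership game\<close>

text \<open>One player names nodes \<open>p\<close>, the other answers with thresholds
  \<open>a\<close>; \<open>R\<close> judges the record. Each round is one quantifier pair, so the
  number of rounds controls the Borel level.\<close>

primrec game :: "nat \<Rightarrow> ((nat \<times> nat) list \<Rightarrow> bool) \<Rightarrow> bool" where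
  "game 0 R \<longleftrightarrow> R []"
| "game (Suc k) R \<longleftrightarrow> (\<forall>p. \<exists>a. game k (\<lambda>L. R ((p, a) # L)))"

text \<open>Answering by \<open>f\<close> regardless of the history is a winning strategy.\<close>

lemma game_if_uniform:
  assumes "\<And>ps. length ps = k \<Longrightarrow> R (map (\<lambda>p. (p, f p)) ps)"
  shows "game k R"
  using assms
proof (induction k arbitrary: R)
  case (Suc k)
  have "game k (\<lambda>L. R ((p, f p) # L))" for p
    using Suc.prems[of "p # _"] by (intro Suc.IH) simp
  then show ?case
    by auto
qed simp

text \<open>If the nodes are played in increasing order, then only finitely many positions end with a given
  node, so one value dominates all answers of a winning strategy there.\<close>

lemma uniform_if_game:
  assumes "game k R"
    and "\<And>L L'. R L \<Longrightarrow> list_all2 (\<lambda>(p, a) (q, b). p = q \<and> a \<le> b) L L' \<Longrightarrow> R L'"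
  shows "\<exists>f. \<forall>ps. length ps = k \<and> sorted ps \<longrightarrow> R (map (\<lambda>p. (p, f p)) ps)"
  using assms
proof (induction k arbitrary: R)
  case (Suc k)
  have "\<forall>p. \<exists>a g. \<forall>ps. length ps = k \<and> sorted ps \<longrightarrow> R ((p, a) # map (\<lambda>q. (q, g q)) ps)"
  proof
    fix p
    obtain a where "game k (\<lambda>L. R ((p, a) # L))"
      using Suc.prems(1) by auto
    then have "\<exists>g. \<forall>ps. length ps = k \<and> sorted ps \<longrightarrow> R ((p, a) # map (\<lambda>q. (q, g q)) ps)"
      by (rule Suc.IH) (rule Suc.prems(2), auto)
    then show "\<exists>a g. \<forall>ps. length ps = k \<and> sorted ps \<longrightarrow> R ((p, a) # map (\<lambda>q. (q, g q)) ps)"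
      by blast
  qed
  \<comment> \<open>\<open>a p\<close> answers the first move \<open>p\<close>, and
    \<open>g p\<close> is a uniform answer for the rounds after it.\<close>
  then obtain a g
    where ag: "\<And>p ps. length ps = k \<Longrightarrow> sorted ps \<Longrightarrow> R ((p, a p) # map (\<lambda>q. (q, g p q)) ps)"
    by metis
  \<comment> \<open>In a sorted play starting with \<open>p\<close> every later node
    \<open>q\<close> satisfies \<open>p \<le> q\<close>, so a finite sum dominates all answers
    needed at \<open>q\<close>.\<close>
  define f where "f q = a q + (\<Sum>p\<le>q. g p q)" for q
  have le: "g p q \<le> f q" if "p \<le> q" for p q
    using member_le_sum[of p "{..q}" "\<lambda>p. g p q"] that by (simp add: f_def)
  have "R (map (\<lambda>p. (p, f p)) ps)" if ps: "length ps = Suc k" "sorted ps" for ps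
  proof -
    obtain p qs where [simp]: "ps = p # qs"
      using ps by (cases ps) auto
    have "R ((p, a p) # map (\<lambda>q. (q, g p q)) qs)"
      using ag ps by simp
    then show ?thesis
      by (rule Suc.prems(2))
        (use ps le in \<open>auto simp: f_def[of p] list_all2_map1 list_all2_map2 intro!: list.rel_refl_strong\<close>)
  qed
  then show ?case
    by blast
qed simp

text \<open>\<open>C x\<close> lists pairs \<open>(q, v)\<close> standing for the conditions
  \<open>v < f q\<close>, one of which \<open>x\<close> has to satisfy. A record \<open>L\<close>
  tests only the points all of whose nodes were played.\<close>

definition constr_met :: "(nat \<Rightarrow> (nat \<times> nat) list) \<Rightarrow> nat set \<Rightarrow> (nat \<times> nat) list \<Rightarrow> bool" where
  "constr_met C A L \<longleftrightarrow> (\<forall>x\<in>A. fst ` set (C x) \<subseteq> fst ` set L \<longrightarrow>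
     (\<exists>q v a. (q, v) \<in> set (C x) \<and> (q, a) \<in> set L \<and> v < a))"

text \<open>Since \<open>C x\<close> has length \<open>k\<close> for every \<open>x\<close>,
  \<open>k\<close> rounds suffice to play all nodes of any single point.\<close>

lemma ex_uniform_iff_game:
  assumes len: "\<And>x. length (C x) = k"
  shows "(\<exists>f. \<forall>x\<in>A. \<exists>(q, v)\<in>set (C x). v < f q) \<longleftrightarrow> game k (constr_met C A)"
proof
  assume "\<exists>f. \<forall>x\<in>A. \<exists>(q, v)\<in>set (C x). v < f q"
  then obtain f where f: "\<forall>x\<in>A. \<exists>(q, v)\<in>set (C x). v < f q" ..
  show "game k (constr_met C A)"
  proof (rule game_if_uniform[where f = f])
    show "constr_met C A (map (\<lambda>p. (p, f p)) ps)" for ps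
      unfolding constr_met_def
    proof (intro ballI impI)
      fix x assume "x \<in> A" and sub: "fst ` set (C x) \<subseteq> fst ` set (map (\<lambda>p. (p, f p)) ps)"
      with f obtain q v where qv: "(q, v) \<in> set (C x)" "v < f q"
        by blast
      then have "q \<in> set ps"
        using sub by force
      with qv show "\<exists>q v a. (q, v) \<in> set (C x) \<and> (q, a) \<in> set (map (\<lambda>p. (p, f p)) ps) \<and> v < a"
        by auto
    qed
  qed
next
  assume "game k (constr_met C A)"
  moreover have "constr_met C A L'"
    if L: "constr_met C A L" "list_all2 (\<lambda>(p, a) (q, b). p = q \<and> a \<le> b) L L'" for L L'
  proof -
    have "map fst L = map fst L'"
      using L(2) by (induction rule: list_all2_induct) auto
    then have "fst ` set L = fst ` set L'"
      by (metis set_map)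
    moreover have "\<exists>b. (q, b) \<in> set L' \<and> a \<le> b" if "(q, a) \<in> set L" for q a
      using L(2) that by (induction rule: list_all2_induct) auto
    ultimately show ?thesis
      using L(1) unfolding constr_met_def by (metis less_le_trans)
  qed
  ultimately obtain f
    where f: "\<And>ps. length ps = k \<Longrightarrow> sorted ps \<Longrightarrow> constr_met C A (map (\<lambda>p. (p, f p)) ps)"
    using uniform_if_game[of k "constr_met C A"] by blast
  have "\<exists>(q, v)\<in>set (C x). v < f q" if "x \<in> A" for x
  proof -
    \<comment> \<open>Playing exactly the nodes of \<open>x\<close> in increasing order makes the
      guard of \<open>constr_met\<close> true for \<open>x\<close>.\<close>
    have "constr_met C A (map (\<lambda>p. (p, f p)) (sort (map fst (C x))))"
      using len by (intro f) auto
    with that show ?thesis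
      unfolding constr_met_def by (force simp: image_image)
  qed
  then show "\<exists>f. \<forall>x\<in>A. \<exists>(q, v)\<in>set (C x). v < f q"
    by blast
qed

section \<open>Borel complexity of the game\<close>

lemma open_coord: "open {y :: nat \<Rightarrow> bool. y n}"
  and open_not_coord: "open {y :: nat \<Rightarrow> bool. \<not> y n}"
proof -
  have "open ((\<lambda>y :: nat \<Rightarrow> bool. y n) -` S)" for S
    by (rule open_vimage) (auto simp: open_discrete intro!: continuous_intros)
  from this[of "{True}"] this[of "{False}"]
  show "open {y :: nat \<Rightarrow> bool. y n}" "open {y :: nat \<Rightarrow> bool. \<not> y n}"
    by (auto simp: vimage_def)
qed

text \<open>Each round adds a countable union over the answers and a countable intersection over the
  nodes, which costs two levels.\<close>

lemma Sigma0_game: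
  assumes "\<And>L. Sigma0 (fin_ord (Suc n)) (- {y. R y L})"
  shows "Sigma0 (fin_ord (Suc (n + 2 * k))) (- {y. game k (R y)})"
  using assms
proof (induction k arbitrary: R)
  case (Suc k)
  define B where "B p a = {y. game k (\<lambda>L. R y ((p, a) # L))}" for p a
  have "Sigma0 (fin_ord (Suc (n + 2 * k))) (- B p a)" for p a
    unfolding B_def by (rule Suc.IH) (rule Suc.prems)
  then have "Sigma0 (fin_ord (Suc (Suc (n + 2 * k)))) (- (- (\<Union>a. B p a)))" for p
    unfolding double_complement by (rule Sigma0_fin_ord_Union)
  then have "Sigma0 (fin_ord (Suc (Suc (Suc (n + 2 * k))))) (\<Union>p. - (\<Union>a. B p a))"
    by (rule Sigma0_fin_ord_Union)
  moreover have "(\<Union>p. - (\<Union>a. B p a)) = - {y. game (Suc k) (R y)}"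
    by (auto simp: B_def)
  ultimately show ?case
    by simp
qed simp

lemma Sigma0_constr_game:
  "Sigma0 (fin_ord (Suc (2 * k))) (- {y. game k (constr_met C {x. y x})})"
proof -
  have "Sigma0 (fin_ord (Suc 0)) (- {y. constr_met C {x. y x} L})" for L
  proof -
    \<comment> \<open>A failure is witnessed by a single point \<open>x\<close>, and whether
      \<open>x\<close> is a witness depends on \<open>y\<close> only through \<open>y x\<close>;
      hence the failure set is open.\<close>
    have "- {y. constr_met C {x. y x} L} = (\<Union>x\<in>{x. \<not> constr_met C {x} L}. {y. y x})"
      unfolding constr_met_def by blast
    then show ?thesis
      by (simp add: one_eq_fin_ord[symmetric] Sigma0_one_iff open_coord open_UN)
  qed
  from Sigma0_game[OF this] show ?thesis
    by simp
qed


section \<open>Threshold functions for \<open>Fin\<^sup>n\<close> and \<open>Fin'\<^sub>\<omega>\<close>\<close>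

text \<open>\<open>f []\<close> bounds the exceptional first coordinates, and
  \<open>\<lambda>u. f (i # u)\<close> serves as the threshold function of the section at
  \<open>i\<close>.\<close>

lemma Fin_pow_Suc_iff:
  "E \<in> Fin_pow (Suc n) \<longleftrightarrow> E \<subseteq> seqs (Suc n) \<and> (\<exists>f. \<forall>s\<in>E. \<exists>l\<le>n. s ! l < f (take l s))"
proof (induction n arbitrary: E)
  case 0
  have "finite E \<longleftrightarrow> (\<exists>f :: nat list \<Rightarrow> nat. \<forall>s\<in>E. s ! 0 < f [])" if "E \<subseteq> seqs (Suc 0)"
  proof -
    have "inj_on (\<lambda>s :: nat list. s ! 0) (seqs (Suc 0))"
      by (auto simp: inj_on_def seqs_def length_Suc_conv)
    then have "inj_on (\<lambda>s. s ! 0) E"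
      using that by (rule inj_on_subset)
    then have "finite E \<longleftrightarrow> finite ((\<lambda>s. s ! 0) ` E)"
      by (simp add: finite_image_iff)
    also have "\<dots> \<longleftrightarrow> (\<exists>m. \<forall>s\<in>E. s ! 0 < m)"
      by (simp add: finite_nat_set_iff_bounded)
    also have "\<dots> \<longleftrightarrow> (\<exists>f :: nat list \<Rightarrow> nat. \<forall>s\<in>E. s ! 0 < f [])"
    proof
      assume "\<exists>m. \<forall>s\<in>E. s ! 0 < m"
      then obtain m where "\<forall>s\<in>E. s ! 0 < m" ..
      then show "\<exists>f :: nat list \<Rightarrow> nat. \<forall>s\<in>E. s ! 0 < f []"
        by (intro exI[of _ "\<lambda>_. m"])
    qed blast
    finally show ?thesis .
  qed
  then show ?case
    by auto
next
  case (Suc n)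
  define S where "S i = {x \<in> seqs (Suc n). i # x \<in> E}" for i
  have "finite {i. S i \<notin> Fin_pow (Suc n)} \<longleftrightarrow> (\<exists>f. \<forall>s\<in>E. \<exists>l\<le>Suc n. s ! l < f (take l s))"
    if E: "E \<subseteq> seqs (Suc (Suc n))"
  proof
    assume "finite {i. S i \<notin> Fin_pow (Suc n)}"
    then obtain m where m: "\<And>i. S i \<notin> Fin_pow (Suc n) \<Longrightarrow> i < m"
      by (auto simp: finite_nat_set_iff_bounded)
    \<comment> \<open>Sections with index below \<open>m\<close> may be large; their points are
      caught at coordinate 0 by \<open>f [] = m\<close>.\<close>
    have "\<forall>i. \<exists>f. m \<le> i \<longrightarrow> (\<forall>x\<in>S i. \<exists>l\<le>n. x ! l < f (take l x))"
      using m Suc.IH by (metis not_le)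
    then obtain g where g: "\<And>i x. m \<le> i \<Longrightarrow> x \<in> S i \<Longrightarrow> \<exists>l\<le>n. x ! l < g i (take l x)"
      by metis
    define f where "f t = (case t of [] \<Rightarrow> m | i # u \<Rightarrow> g i u)" for t
    have "\<exists>l\<le>Suc n. s ! l < f (take l s)" if sE: "s \<in> E" for s
    proof -
      obtain i x where s: "s = i # x" "length x = Suc n"
        using sE E by (auto simp: seqs_def length_Suc_conv)
      show ?thesis
      proof (cases "i < m")
        case True
        then show ?thesis
          by (intro exI[of _ 0]) (simp add: f_def s)
      next
        case False
        then obtain l where "l \<le> n" "x ! l < g i (take l x)"
          using g[of i x] sE s by (auto simp: S_def seqs_def)
        then show ?thesis
          by (intro exI[of _ "Suc l"]) (simp add: f_def s)
      qed
    qed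
    then show "\<exists>f. \<forall>s\<in>E. \<exists>l\<le>Suc n. s ! l < f (take l s)"
      by blast
  next
    assume "\<exists>f. \<forall>s\<in>E. \<exists>l\<le>Suc n. s ! l < f (take l s)"
    then obtain f where f: "\<And>s. s \<in> E \<Longrightarrow> \<exists>l\<le>Suc n. s ! l < f (take l s)"
      by blast
    have "S i \<in> Fin_pow (Suc n)" if "f [] \<le> i" for i
    proof -
      have "\<exists>l\<le>n. x ! l < f (i # take l x)" if "x \<in> S i" for x
      proof -
        from that obtain l where "l \<le> Suc n" "(i # x) ! l < f (take l (i # x))"
          using f[of "i # x"] by (auto simp: S_def)
        with \<open>f [] \<le> i\<close> show ?thesis
          by (cases l) auto
      qed
      moreover have "S i \<subseteq> seqs (Suc n)"
        by (auto simp: S_def)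
      ultimately show ?thesis
        unfolding Suc.IH by (intro conjI exI[of _ "\<lambda>t. f (i # t)"]) auto
    qed
    then have "{i. S i \<notin> Fin_pow (Suc n)} \<subseteq> {..<f []}"
      by (auto simp: not_le[symmetric])
    then show "finite {i. S i \<notin> Fin_pow (Suc n)}"
      using finite_subset by blast
  qed
  then show ?case
    by (auto simp: S_def)
qed

lemma Fin_pow_Suc_subset:
  "E \<in> Fin_pow (Suc n) \<Longrightarrow> D \<subseteq> E \<Longrightarrow> D \<in> Fin_pow (Suc n)"
  unfolding Fin_pow_Suc_iff by (meson order_trans subset_iff)

lemma Fin_pow_Suc_Un:
  assumes "D \<in> Fin_pow (Suc n)" "E \<in> Fin_pow (Suc n)"
  shows "D \<union> E \<in> Fin_pow (Suc n)"
proof -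
  obtain f g where "\<forall>s\<in>D. \<exists>l\<le>n. s ! l < f (take l s)" "\<forall>s\<in>E. \<exists>l\<le>n. s ! l < g (take l s)"
    using assms unfolding Fin_pow_Suc_iff by blast
  then have "\<forall>s\<in>D \<union> E. \<exists>l\<le>n. s ! l < max (f (take l s)) (g (take l s))"
    by (auto simp: less_max_iff_disj)
  with assms show ?thesis
    unfolding Fin_pow_Suc_iff by (intro conjI exI[of _ "\<lambda>t. max (f t) (g t)"]) auto
qed

section \<open>Blocks and coordinates of points\<close>

definition cell :: "(nat list \<Rightarrow> nat set) \<Rightarrow> nat \<Rightarrow> nat \<Rightarrow> nat list" where
  "cell X n x = (THE s. s \<in> seqs (Suc n) \<and> x \<in> X s)"

text \<open>The point of \<open>\<omega>\<^bsup>n+2\<^esup>\<close> corresponding to \<open>x\<close>; the map \<open>pt X n\<close> is not onto, but its image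
  meets every \<open>{s} \<times> \<omega>\<close> in an infinite set.\<close>

definition pt :: "(nat list \<Rightarrow> nat set) \<Rightarrow> nat \<Rightarrow> nat \<Rightarrow> nat list" where
  "pt X n x = cell X n x @ [x]"

lemma ex1_cell:
  assumes "partition_into_infinite (seqs (n + 1)) X"
  shows "\<exists>!s. s \<in> seqs (Suc n) \<and> x \<in> X s"
proof -
  have "disjoint_family_on X (seqs (Suc n))" "x \<in> (\<Union>s\<in>seqs (Suc n). X s)"
    using assms by (simp_all add: partition_into_infinite_def)
  then show ?thesis
    using disjoint_family_onD by fastforce
qed

lemma
  assumes "partition_into_infinite (seqs (n + 1)) X"
  shows cell_in_seqs: "cell X n x \<in> seqs (Suc n)"
    and mem_cell: "x \<in> X (cell X n x)"
  using theI'[OF ex1_cell[OF assms]] unfolding cell_def by simp_all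

lemma cell_eqI:
  assumes "partition_into_infinite (seqs (n + 1)) X" "s \<in> seqs (Suc n)" "x \<in> X s"
  shows "cell X n x = s"
  unfolding cell_def using ex1_cell[OF assms(1)] assms(2,3) by (intro the1_equality conjI)

text \<open>The last coordinate of \<open>pt X n x\<close> is \<open>x\<close> itself, so a
  threshold at a full index \<open>s\<close> expresses finiteness of
  \<open>A \<inter> X s\<close>.\<close>

lemma Fin_part_iff:
  assumes X: "partition_into_infinite (seqs (n + 1)) X"
  shows "A \<in> Fin_part n X \<longleftrightarrow> (\<exists>f. \<forall>x\<in>A. \<exists>l\<le>Suc n. pt X n x ! l < f (take l (pt X n x)))"
    (is "_ \<longleftrightarrow> ?R")
proof -
  define E where "E = {s \<in> seqs (Suc n). infinite (A \<inter> X s)}"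
  have len: "length (cell X n x) = Suc n" for x
    using cell_in_seqs[OF X] by (simp add: seqs_def)
  have "A \<in> Fin_part n X \<longleftrightarrow> (\<exists>f. \<forall>s\<in>E. \<exists>l\<le>n. s ! l < f (take l s))"
    by (auto simp: Fin_part_def Fin_pow_Suc_iff E_def)
  also have "\<dots> \<longleftrightarrow> ?R"
  proof
    assume "\<exists>f. \<forall>s\<in>E. \<exists>l\<le>n. s ! l < f (take l s)"
    then obtain f where f: "\<And>s. s \<in> E \<Longrightarrow> \<exists>l\<le>n. s ! l < f (take l s)"
      by blast
    have "\<forall>s. \<exists>m. finite (A \<inter> X s) \<longrightarrow> (\<forall>x\<in>A \<inter> X s. x < m)"
      by (auto simp: finite_nat_set_iff_bounded)
    then obtain b where b: "\<And>s x. finite (A \<inter> X s) \<Longrightarrow> x \<in> A \<inter> X s \<Longrightarrow> x < b s"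
      by metis
    \<comment> \<open>\<open>f\<close> takes effect on prefixes of length at most \<open>n\<close>,
      \<open>b\<close> on the full index of length \<open>Suc n\<close>; the maximum serves
      both.\<close>
    have "\<exists>l\<le>Suc n. pt X n x ! l < max (f (take l (pt X n x))) (b (take l (pt X n x)))"
      if "x \<in> A" for x
    proof (cases "cell X n x \<in> E")
      case True
      then obtain l where "l \<le> n" "cell X n x ! l < f (take l (cell X n x))"
        using f by blast
      then show ?thesis
        by (intro exI[of _ l]) (auto simp: pt_def nth_append len)
    next
      case False
      then have "x < b (cell X n x)"
        using that mem_cell[OF X] cell_in_seqs[OF X] by (intro b) (auto simp: E_def)
      then show ?thesis
        by (intro exI[of _ "Suc n"]) (auto simp: pt_def nth_append len)
    qed
    then show ?R
      by (intro exI[of _ "\<lambda>t. max (f t) (b t)"]) blast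
  next
    assume ?R
    then obtain f where f: "\<And>x. x \<in> A \<Longrightarrow> \<exists>l\<le>Suc n. pt X n x ! l < f (take l (pt X n x))"
      by blast
    have "\<exists>l\<le>n. s ! l < f (take l s)" if "s \<in> E" for s
    proof -
      \<comment> \<open>Some \<open>x\<close> in the infinite intersection escapes the threshold at
        \<open>s\<close>, so its condition must be met by a coordinate of \<open>s\<close>.\<close>
      have "\<not> A \<inter> X s \<subseteq> {..<f s}"
        using that finite_subset by (auto simp: E_def)
      then obtain x where x: "x \<in> A" "x \<in> X s" "f s \<le> x"
        by (meson IntE lessThan_iff not_less subsetI)
      then have s: "cell X n x = s"
        using that by (intro cell_eqI[OF X]) (auto simp: E_def)
      obtain l where l: "l \<le> Suc n" "pt X n x ! l < f (take l (pt X n x))"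
        using f x by blast
      with x s len[of x] have "l \<noteq> Suc n"
        by (auto simp: pt_def nth_append)
      with l s len[of x] show ?thesis
        by (intro exI[of _ l]) (auto simp: pt_def nth_append)
    qed
    then show "\<exists>f. \<forall>s\<in>E. \<exists>l\<le>n. s ! l < f (take l s)"
      by blast
  qed
  finally show ?thesis .
qed

text \<open>Finitely many generators merge into one \<open>f\<close> by summing their thresholds,
  and the sum of their indices bounds \<open>N\<close>. Conversely \<open>f\<close> cuts out one
  generator for each \<open>n \<le> N\<close>.\<close>

lemma Fin'_omega_iff:
  assumes X: "\<And>n. partition_into_infinite (seqs (n + 1)) X"
  shows "A \<in> Fin'_omega X \<longleftrightarrow>
    (\<exists>N f. \<forall>x\<in>A. \<exists>n\<le>N. \<exists>l\<le>Suc n. pt X n x ! l < f n (take l (pt X n x)))"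
    (is "_ \<longleftrightarrow> ?R")
proof
  assume "A \<in> Fin'_omega X"
  then obtain \<F> where \<F>: "finite \<F>" "\<F> \<subseteq> (\<Union>n. Fin_part n X)" "A \<subseteq> \<Union>\<F>"
    by (auto simp: Fin'_omega_def)
  then have "\<forall>B\<in>\<F>. \<exists>n f. \<forall>x\<in>B. \<exists>l\<le>Suc n. pt X n x ! l < f (take l (pt X n x))"
    using Fin_part_iff[OF X] by blast
  then obtain m f where mf:
    "\<And>B x. B \<in> \<F> \<Longrightarrow> x \<in> B \<Longrightarrow> \<exists>l\<le>Suc (m B). pt X (m B) x ! l < f B (take l (pt X (m B) x))"
    by metis
  have le: "f B t \<le> (\<Sum>B\<in>\<F>. f B t)" "m B \<le> (\<Sum>B\<in>\<F>. m B)" if "B \<in> \<F>" for B t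
    using that \<F>(1) by (auto intro: member_le_sum)
  have "\<exists>n\<le>(\<Sum>B\<in>\<F>. m B). \<exists>l\<le>Suc n. pt X n x ! l < (\<Sum>B\<in>\<F>. f B (take l (pt X n x)))"
    if x: "x \<in> A" for x
  proof -
    obtain B where B: "B \<in> \<F>" "x \<in> B"
      using x \<F>(3) by blast
    then show ?thesis
      using mf[OF B] le[OF B(1)] by (meson less_le_trans)
  qed
  then show ?R
    by (intro exI[of _ "\<Sum>B\<in>\<F>. m B"] exI[of _ "\<lambda>n t. \<Sum>B\<in>\<F>. f B t"]) blast
next
  assume ?R
  then obtain N f
    where f: "\<And>x. x \<in> A \<Longrightarrow> \<exists>n\<le>N. \<exists>l\<le>Suc n. pt X n x ! l < f n (take l (pt X n x))"
    by blast
  define B where "B n = {x. \<exists>l\<le>Suc n. pt X n x ! l < f n (take l (pt X n x))}" for n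
  have "B n \<in> Fin_part n X" for n
    unfolding Fin_part_iff[OF X] B_def by blast
  moreover have "A \<subseteq> \<Union>(B ` {..N})"
    using f unfolding B_def by blast
  ultimately show "A \<in> Fin'_omega X"
    unfolding Fin'_omega_def by (intro CollectI exI[of _ "B ` {..N}"]) auto
qed

section \<open>Properness of the ideal\<close>

lemma ex_seq_above: "\<exists>s\<in>seqs n. \<forall>l<n. (f :: nat list \<Rightarrow> nat) (take l s) \<le> s ! l"
proof (induction n)
  case (Suc n)
  then obtain s where s: "length s = n" "\<forall>l<n. f (take l s) \<le> s ! l"
    by (auto simp: seqs_def)
  then show ?case
    by (intro bexI[of _ "s @ [f s]"]) (auto simp: seqs_def nth_append less_Suc_eq)
qed (simp add: seqs_def)

text \<open>The hypothesis \<open>inf\<close> makes the ideal proper: choose for each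
  \<open>n \<le> N\<close> a block index above all thresholds, then a large \<open>x\<close> common
  to these blocks; it violates every condition.\<close>

lemma ideal_Fin'_omega:
  assumes X: "\<And>n. partition_into_infinite (seqs (n + 1)) X"
    and inf: "\<And>(F :: nat set) s. finite F \<Longrightarrow> (\<And>i. i \<in> F \<Longrightarrow> s i \<in> seqs (i + 1)) \<Longrightarrow>
      infinite (\<Inter>i\<in>F. X (s i))"
  shows "ideal_on_nat (Fin'_omega X)"
  unfolding ideal_on_nat_def
proof (intro conjI ballI allI impI)
  show "B \<in> Fin'_omega X" if "A \<in> Fin'_omega X" "B \<subseteq> A" for A B
    using that unfolding Fin'_omega_def by blast
  show "A \<union> B \<in> Fin'_omega X" if AB: "A \<in> Fin'_omega X" "B \<in> Fin'_omega X" for A B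
  proof -
    obtain \<F> where \<F>: "finite \<F>" "\<F> \<subseteq> (\<Union>n. Fin_part n X)" "A \<subseteq> \<Union>\<F>"
      using AB(1) unfolding Fin'_omega_def by blast
    obtain \<G> where \<G>: "finite \<G>" "\<G> \<subseteq> (\<Union>n. Fin_part n X)" "B \<subseteq> \<Union>\<G>"
      using AB(2) unfolding Fin'_omega_def by blast
    have "finite (\<F> \<union> \<G>)" "\<F> \<union> \<G> \<subseteq> (\<Union>n. Fin_part n X)" "A \<union> B \<subseteq> \<Union>(\<F> \<union> \<G>)"
      using \<F> \<G> by auto
    then show ?thesis
      unfolding Fin'_omega_def by blast
  qed
  show "A \<in> Fin'_omega X" if "finite A" for A
  proof -
    have "A \<in> Fin_part 0 X"
      using that by (simp add: Fin_part_def)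
    then show ?thesis
      unfolding Fin'_omega_def by (intro CollectI exI[of _ "{A}"]) auto
  qed
  show "UNIV \<notin> Fin'_omega X"
  proof
    assume "UNIV \<in> Fin'_omega X"
    then obtain N f where f: "\<And>x. \<exists>n\<le>N. \<exists>l\<le>Suc n. pt X n x ! l < f n (take l (pt X n x))"
      unfolding Fin'_omega_iff[OF X] by blast
    have "\<forall>n. \<exists>s\<in>seqs (Suc n). \<forall>l<Suc n. f n (take l s) \<le> s ! l"
      using ex_seq_above by blast
    then obtain s where s: "\<And>n. s n \<in> seqs (Suc n)"
        "\<And>n l. l < Suc n \<Longrightarrow> f n (take l (s n)) \<le> s n ! l"
      by metis
    have "infinite (\<Inter>n\<in>{..N}. X (s n))"
      using s by (intro inf) auto
    then have "\<not> (\<Inter>n\<in>{..N}. X (s n)) \<subseteq> {..<\<Sum>n\<le>N. f n (s n)}"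
      using finite_subset by blast
    then obtain x where "x \<in> (\<Inter>n\<in>{..N}. X (s n))" "x \<notin> {..<\<Sum>n\<le>N. f n (s n)}"
      by blast
    then have x: "\<And>n. n \<le> N \<Longrightarrow> x \<in> X (s n)" "(\<Sum>n\<le>N. f n (s n)) \<le> x"
      by auto
    obtain n l where nl: "n \<le> N" "l \<le> Suc n" "pt X n x ! l < f n (take l (pt X n x))"
      using f by blast
    have c: "cell X n x = s n"
      using s x nl by (intro cell_eqI[OF X]) auto
    have len: "length (s n) = Suc n"
      using s by (simp add: seqs_def)
    have "f n (s n) \<le> x"
      using x(2) nl(1) member_le_sum[of n "{..N}" "\<lambda>n. f n (s n)"] by simp
    \<comment> \<open>The coordinate at \<open>l = Suc n\<close> is \<open>x\<close> itself; smaller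
      \<open>l\<close> give coordinates of \<open>s n\<close>.\<close>
    with nl s(2)[of l n] show False
      by (cases "l = Suc n") (auto simp: pt_def c nth_append len)
  qed
qed

section \<open>The ideal as a countable union of games\<close>

definition constr :: "(nat list \<Rightarrow> nat set) \<Rightarrow> nat \<Rightarrow> nat \<Rightarrow> (nat \<times> nat) list" where
  "constr X N x = concat (map (\<lambda>n. map (\<lambda>l. (to_nat (n, take l (pt X n x)), pt X n x ! l))
     [0..<Suc (Suc n)]) [0..<Suc N])"

text \<open>Coding the nodes \<open>(n, t)\<close> by \<open>to_nat\<close> merges the functions
  \<open>f n\<close> into a single function on naturals. The list \<open>constr X N x\<close> has
  the same length for all \<open>x\<close>, which fixes the number of rounds for each
  \<open>N\<close>.\<close>

lemma Fin'_omega_iff_game: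
  assumes X: "\<And>n. partition_into_infinite (seqs (n + 1)) X"
  shows "A \<in> Fin'_omega X \<longleftrightarrow>
    (\<exists>N. game (\<Sum>n\<leftarrow>[0..<Suc N]. Suc (Suc n)) (constr_met (constr X N) A))"
proof -
  have set_constr: "set (constr X N x) =
      {(to_nat (n, take l (pt X n x)), pt X n x ! l) | n l. n \<le> N \<and> l \<le> Suc n}" for N x
    by (force simp: constr_def less_Suc_eq_le simp del: upt_Suc)
  have met_iff: "(\<exists>(q, v)\<in>set (constr X N x). v < g q) \<longleftrightarrow>
      (\<exists>n\<le>N. \<exists>l\<le>Suc n. pt X n x ! l < g (to_nat (n, take l (pt X n x))))" for N x g
    unfolding set_constr by blast
  have "(\<exists>f. \<forall>x\<in>A. \<exists>n\<le>N. \<exists>l\<le>Suc n. pt X n x ! l < f n (take l (pt X n x))) \<longleftrightarrow>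
      (\<exists>g. \<forall>x\<in>A. \<exists>(q, v)\<in>set (constr X N x). v < g q)" for N
  proof
    assume "\<exists>f. \<forall>x\<in>A. \<exists>n\<le>N. \<exists>l\<le>Suc n. pt X n x ! l < f n (take l (pt X n x))"
    then obtain f where "\<forall>x\<in>A. \<exists>n\<le>N. \<exists>l\<le>Suc n. pt X n x ! l < f n (take l (pt X n x))" ..
    then show "\<exists>g. \<forall>x\<in>A. \<exists>(q, v)\<in>set (constr X N x). v < g q"
      unfolding met_iff by (intro exI[of _ "\<lambda>q. case_prod f (from_nat q)"]) simp
  next
    assume "\<exists>g. \<forall>x\<in>A. \<exists>(q, v)\<in>set (constr X N x). v < g q"
    then obtain g where "\<forall>x\<in>A. \<exists>(q, v)\<in>set (constr X N x). v < g q" ..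
    then show "\<exists>f. \<forall>x\<in>A. \<exists>n\<le>N. \<exists>l\<le>Suc n. pt X n x ! l < f n (take l (pt X n x))"
      unfolding met_iff by (intro exI[of _ "\<lambda>n t. g (to_nat (n, t))"])
  qed
  moreover have "length (constr X N x) = (\<Sum>n\<leftarrow>[0..<Suc N]. Suc (Suc n))" for N x
    unfolding constr_def length_concat map_map by (rule arg_cong[of _ _ sum_list]) simp
  ultimately show ?thesis
    unfolding Fin'_omega_iff[OF X] by (simp only: ex_uniform_iff_game)
qed

lemma image_charfun: "(\<lambda>A n. n \<in> A) ` \<S> = {y. {n. y n} \<in> \<S>}"
proof (intro equalityI subsetI)
  fix y assume "y \<in> {y. {n. y n} \<in> \<S>}"
  then show "y \<in> (\<lambda>A n. n \<in> A) ` \<S>"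
    by (intro image_eqI[of _ _ "{n. y n}"]) auto
qed auto

text \<open>The levels of the games are finite but grow with \<open>N\<close>, so their union is
  placed at \<open>omega\<close>.\<close>

lemma Fin'_omega_Sigma0_omega:
  assumes X: "\<And>n. partition_into_infinite (seqs (n + 1)) X"
  shows "Fin'_omega X \<in> Sigma0_fam omega"
proof -
  define k :: "nat \<Rightarrow> nat" where "k N = (\<Sum>n\<leftarrow>[0..<Suc N]. Suc (Suc n))" for N
  have "(\<lambda>A n. n \<in> A) ` Fin'_omega X = {y. {x. y x} \<in> Fin'_omega X}"
    by (rule image_charfun)
  also have "\<dots> = (\<Union>N. {y. game (k N) (constr_met (constr X N) {x. y x})})"
    unfolding Fin'_omega_iff_game[OF X] k_def by blast
  also have "Sigma0 omega \<dots>"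
  proof (rule Sigma0.countable_Union)
    show "1 < omega"
      by (simp only: one_eq_fin_ord fin_ord_less_omega)
    show "\<exists>\<beta>\<ge>1. \<beta> < omega \<and> Sigma0 \<beta> (- {y. game (k N) (constr_met (constr X N) {x. y x})})" for N
      using Sigma0_constr_game fin_ord_less_omega
      by (intro exI[of _ "fin_ord (Suc (2 * k N))"]) (auto simp: one_eq_fin_ord)
  qed
  finally show ?thesis
    by (simp add: Sigma0_fam_def)
qed


section \<open>Universal sets and the lower bound\<close>

text \<open>\<open>k\<close> codes a finite bit string, read as a prescribed initial segment; every
  natural number is a valid code.\<close>

definition cyl :: "nat \<Rightarrow> (nat \<Rightarrow> bool) set" where
  "cyl k = {x. \<forall>i<length (from_nat k :: bool list). x i = from_nat k ! i}"

lemma open_eq_coord: "open {x :: nat \<Rightarrow> bool. x i = b}"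
  by (cases b) (simp_all add: open_coord open_not_coord)

lemma clopen_cyl: "open (cyl k)" "open (- cyl k)"
proof -
  have "cyl k = (\<Inter>i<length (from_nat k :: bool list). {x. x i = from_nat k ! i})"
    by (auto simp: cyl_def)
  also have "open \<dots>"
    by (intro open_INT) (auto simp: open_eq_coord)
  finally show "open (cyl k)" .
  have "- cyl k = (\<Union>i<length (from_nat k :: bool list). {x. x i = (\<not> from_nat k ! i)})"
    by (auto simp: cyl_def)
  also have "open \<dots>"
    by (intro open_UN) (auto simp: open_eq_coord)
  finally show "open (- cyl k)" .
qed

lemma open_imp_Union_cyl:
  assumes "open U"
  shows "U = (\<Union>k\<in>{k. cyl k \<subseteq> U}. cyl k)"
proof (intro equalityI subsetI)
  fix x assume "x \<in> U"
  then obtain B where B: "x \<in> Pi\<^sub>E UNIV B" "finite {i. B i \<noteq> UNIV}" "Pi\<^sub>E UNIV B \<subseteq> U"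
    using product_topology_open_contains_basis[of "\<lambda>_. euclidean" UNIV U x] assms
    by (auto simp: open_fun_def)
  obtain n where n: "\<And>i. B i \<noteq> UNIV \<Longrightarrow> i < n"
    using B(2) by (auto simp: finite_nat_set_iff_bounded)
  define k where "k = to_nat (map x [0..<n])"
  have "y \<in> U" if "y \<in> cyl k" for y
  proof -
    have "y i \<in> B i" for i
      using that n[of i] B(1) by (cases "i < n") (auto simp: cyl_def k_def PiE_iff)
    then show ?thesis
      using B(3) by (auto simp: PiE_iff)
  qed
  moreover have "x \<in> cyl k"
    by (simp add: cyl_def k_def)
  ultimately show "x \<in> (\<Union>k\<in>{k. cyl k \<subseteq> U}. cyl k)"
    by blast
qed auto

text \<open>\<open>usig n c\<close> is the section at the code \<open>c\<close> of a universal set for the Borel level \<open>n + 1\<close>.\<close>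

primrec usig :: "nat \<Rightarrow> (nat \<Rightarrow> bool) \<Rightarrow> (nat \<Rightarrow> bool) set" where
  "usig 0 c = (\<Union>k\<in>{k. c k}. cyl k)"
| "usig (Suc n) c = (\<Union>k. - usig n (\<lambda>j. c (prod_encode (k, j))))"

lemma usig_Union:
  assumes "\<And>k :: nat. - A k \<in> range (usig n)"
  shows "(\<Union>k. A k) \<in> range (usig (Suc n))"
proof -
  have "\<forall>k. \<exists>d. - A k = usig n d"
    using assms by blast
  then obtain d where d: "\<And>k. - A k = usig n (d k)"
    by metis
  \<comment> \<open>The codes \<open>d k\<close> are spliced into the rows of a single code.\<close>
  have "usig (Suc n) (\<lambda>m. case_prod d (prod_decode m)) = (\<Union>k. A k)"
    by (simp flip: d)
  then show ?thesis
    by (metis rangeI)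
qed

lemma open_in_range_usig:
  assumes "open U"
  shows "U \<in> range (usig 0)"
proof -
  have "U = usig 0 (\<lambda>k. cyl k \<subseteq> U)"
    using open_imp_Union_cyl[OF assms] by simp
  then show ?thesis
    by blast
qed

text \<open>Rests on cylinders being clopen: an open set is then a countable union of closed ones,
  with empty sets as padding.\<close>

lemma range_usig_Suc: "range (usig n) \<subseteq> range (usig (Suc n))"
proof (induction n)
  case 0
  have "usig 0 c \<in> range (usig (Suc 0))" for c
  proof -
    have "usig 0 c = (\<Union>k. if c k then cyl k else {})"
      by auto
    also have "\<dots> \<in> range (usig (Suc 0))"
      by (rule usig_Union) (auto intro!: open_in_range_usig simp: clopen_cyl simp del: usig.simps)
    finally show ?thesis .
  qed
  then show ?case
    by blast
next
  case (Suc n)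
  have "usig (Suc n) c \<in> range (usig (Suc (Suc n)))" for c
    unfolding usig.simps(2)[of n] using Suc by (intro usig_Union) auto
  then show ?case
    by blast
qed

text \<open>Universality of \<open>usig n\<close>. The differing levels of the pieces are first
  raised to a common one by monotonicity.\<close>

lemma Sigma0_in_range_usig:
  assumes "Sigma0 (fin_ord (Suc n)) S"
  shows "S \<in> range (usig n)"
  using assms
proof (induction n arbitrary: S rule: less_induct)
  case (less n)
  show ?case
  proof (cases n)
    case 0
    with less.prems show ?thesis
      by (simp add: Sigma0_one_iff open_in_range_usig del: usig.simps flip: one_eq_fin_ord)
  next
    case (Suc m)
    obtain A :: "nat \<Rightarrow> (nat \<Rightarrow> bool) set"
      where A: "S = (\<Union>k. A k)" "\<forall>k. \<exists>j\<le>m. Sigma0 (fin_ord (Suc j)) (- A k)"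
      using Sigma0_fin_ord_SucD[OF less.prems[unfolded Suc]] by blast
    have "- A k \<in> range (usig m)" for k
    proof -
      obtain j where "j \<le> m" "Sigma0 (fin_ord (Suc j)) (- A k)"
        using A(2) by blast
      then have "- A k \<in> range (usig j)"
        using less.IH Suc by simp
      moreover have "range (usig j) \<subseteq> range (usig m)"
        using \<open>j \<le> m\<close> by (rule lift_Suc_mono_le[of "\<lambda>n. range (usig n)", OF range_usig_Suc])
      ultimately show ?thesis
        by blast
    qed
    then show ?thesis
      unfolding A(1) Suc by (rule usig_Union)
  qed
qed

text \<open>Clopen membership of each \<open>s\<close> means that \<open>f\<close> is continuous
  into the product space of subsets of \<open>seqs m\<close>. Points outside \<open>S\<close> must
  be sent into the dual filter, not merely outside \<open>Fin_pow m\<close>.\<close>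

definition reducible :: "nat \<Rightarrow> (nat \<Rightarrow> bool) set \<Rightarrow> bool" where
  "reducible m S \<longleftrightarrow> (\<exists>f. (\<forall>x. f x \<subseteq> seqs m) \<and>
     (\<forall>s. open {x. s \<in> f x} \<and> open {x. s \<notin> f x}) \<and>
     (\<forall>x. if x \<in> S then f x \<in> Fin_pow m else seqs m - f x \<in> Fin_pow m))"

lemma reducible_clopen:
  assumes "open S" "open (- S)"
  shows "reducible (Suc m) S"
  unfolding reducible_def
proof (intro exI conjI allI)
  let ?f = "\<lambda>x. if x \<in> S then {} else seqs (Suc m)"
  show "?f x \<subseteq> seqs (Suc m)" for x
    by auto
  have "{x. s \<in> ?f x} = (if s \<in> seqs (Suc m) then - S else {})"
    "{x. s \<notin> ?f x} = (if s \<in> seqs (Suc m) then S else UNIV)" for s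
    by auto
  then show "open {x. s \<in> ?f x}" "open {x. s \<notin> ?f x}" for s
    using assms by simp_all
  show "if x \<in> S then ?f x \<in> Fin_pow (Suc m) else seqs (Suc m) - ?f x \<in> Fin_pow (Suc m)" for x
    by (simp add: Fin_pow_Suc_iff)
qed

lemma reducible_Compl:
  assumes "reducible m S"
  shows "reducible m (- S)"
proof -
  obtain f where f: "\<And>x. f x \<subseteq> seqs m" "\<And>s. open {x. s \<in> f x}" "\<And>s. open {x. s \<notin> f x}"
    "\<And>x. if x \<in> S then f x \<in> Fin_pow m else seqs m - f x \<in> Fin_pow m"
    using assms unfolding reducible_def by blast
  have "{x. s \<in> seqs m - f x} = (if s \<in> seqs m then {x. s \<notin> f x} else {})"
    "{x. s \<notin> seqs m - f x} = (if s \<in> seqs m then {x. s \<in> f x} else UNIV)" for s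
    by auto
  moreover have "seqs m - (seqs m - f x) = f x" for x
    using f(1)[of x] by blast
  ultimately show ?thesis
    unfolding reducible_def using f(2-4) by (intro exI[of _ "\<lambda>x. seqs m - f x"]) auto
qed

text \<open>Intersecting the two values works: it is small if either one is, and it is co-small if
  both are.\<close>

lemma reducible_Un:
  assumes "reducible (Suc m) S" "reducible (Suc m) T"
  shows "reducible (Suc m) (S \<union> T)"
proof -
  let ?F = "Fin_pow (Suc m)" and ?U = "seqs (Suc m)"
  obtain f where f: "\<And>x. f x \<subseteq> ?U" "\<And>s. open {x. s \<in> f x}" "\<And>s. open {x. s \<notin> f x}"
    "\<And>x. if x \<in> S then f x \<in> ?F else ?U - f x \<in> ?F"
    using assms(1) unfolding reducible_def by blast
  obtain g where g: "\<And>x. g x \<subseteq> ?U" "\<And>s. open {x. s \<in> g x}" "\<And>s. open {x. s \<notin> g x}"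
    "\<And>x. if x \<in> T then g x \<in> ?F else ?U - g x \<in> ?F"
    using assms(2) unfolding reducible_def by blast
  have "\<forall>x. if x \<in> S \<union> T then f x \<inter> g x \<in> ?F else ?U - (f x \<inter> g x) \<in> ?F"
  proof
    show "if x \<in> S \<union> T then f x \<inter> g x \<in> ?F else ?U - (f x \<inter> g x) \<in> ?F" for x
      using f(4)[of x] g(4)[of x] Fin_pow_Suc_subset[of "f x" m "f x \<inter> g x"]
        Fin_pow_Suc_subset[of "g x" m "f x \<inter> g x"] Fin_pow_Suc_Un[of "?U - f x" m "?U - g x"]
      by (auto simp: Diff_Int)
  qed
  moreover have "{x. s \<in> f x \<inter> g x} = {x. s \<in> f x} \<inter> {x. s \<in> g x}"
    "{x. s \<notin> f x \<inter> g x} = {x. s \<notin> f x} \<union> {x. s \<notin> g x}" for s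
    by auto
  moreover have "f x \<inter> g x \<subseteq> ?U" for x
    using f(1) by blast
  ultimately show ?thesis
    unfolding reducible_def using f(2,3) g(2,3)
    by (intro exI[of _ "\<lambda>x. f x \<inter> g x"]) (simp only: open_Int open_Un simp_thms)
qed

lemma reducible_UN_atMost:
  assumes "\<And>j :: nat. reducible (Suc m) (S j)"
  shows "reducible (Suc m) (\<Union>j\<le>n. S j)"
proof (induction n)
  case (Suc n)
  then show ?case
    by (simp add: atMost_Suc reducible_Un assms)
qed (simp add: assms)

text \<open>The section at \<open>j\<close> reduces the finite union of \<open>S 0\<close> to
  \<open>S j\<close>. Once \<open>x\<close> lies in some \<open>S i\<close>, all sections from
  \<open>i\<close> on are small; if \<open>x\<close> lies in none, every section is
  co-small.\<close>

lemma reducible_Union: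
  assumes "\<And>j :: nat. reducible (Suc m) (S j)"
  shows "reducible (Suc (Suc m)) (\<Union>j. S j)"
proof -
  let ?F = "Fin_pow (Suc m)" and ?U = "seqs (Suc m)"
  have "\<forall>j. \<exists>f. (\<forall>x. f x \<subseteq> ?U) \<and> (\<forall>s. open {x. s \<in> f x} \<and> open {x. s \<notin> f x}) \<and>
      (\<forall>x. if x \<in> (\<Union>i\<le>j. S i) then f x \<in> ?F else ?U - f x \<in> ?F)"
    using reducible_UN_atMost[where S = S, OF assms] unfolding reducible_def by (rule allI)
  from choice[OF this] obtain g where
    "\<forall>j. (\<forall>x. g j x \<subseteq> ?U) \<and> (\<forall>s. open {x. s \<in> g j x} \<and> open {x. s \<notin> g j x}) \<and>
      (\<forall>x. if x \<in> (\<Union>i\<le>j. S i) then g j x \<in> ?F else ?U - g j x \<in> ?F)"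
    by (rule exE)
  then have g: "\<And>j x. g j x \<subseteq> ?U"
      "\<And>j s. open {x. s \<in> g j x}" "\<And>j s. open {x. s \<notin> g j x}"
      "\<And>j x. if x \<in> (\<Union>i\<le>j. S i) then g j x \<in> ?F else ?U - g j x \<in> ?F"
    by simp_all
  define f where "f x = {j # t | j t. t \<in> g j x}" for x
  have sec: "{t \<in> ?U. j # t \<in> f x} = g j x"
    "{t \<in> ?U. j # t \<in> seqs (Suc (Suc m)) - f x} = ?U - g j x" for j x
    using g(1)[of j x] by (auto simp: f_def seqs_def)
  have sub: "f x \<subseteq> seqs (Suc (Suc m))" for x
    using g(1) by (fastforce simp: f_def seqs_def)
  have "open {x. s \<in> f x} \<and> open {x. s \<notin> f x}" for s
    using g(2,3) by (cases s) (simp_all add: f_def)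
  moreover have "f x \<in> Fin_pow (Suc (Suc m))" if x: "x \<in> (\<Union>j. S j)" for x
  proof -
    obtain i where "x \<in> S i"
      using x by blast
    then have "g j x \<in> ?F" if "i \<le> j" for j
      using g(4)[where j = j and x = x] that by (auto split: if_splits)
    then have "{j. g j x \<notin> ?F} \<subseteq> {..<i}"
      by (auto simp: not_le[symmetric])
    then have "finite {j. g j x \<notin> ?F}"
      using finite_subset by blast
    with sub sec show ?thesis
      by simp
  qed
  moreover have "seqs (Suc (Suc m)) - f x \<in> Fin_pow (Suc (Suc m))" if "x \<notin> (\<Union>j. S j)" for x
  proof -
    have "?U - g j x \<in> ?F" for j
      using g(4)[where j = j and x = x] that by (auto split: if_splits)
    with sec show ?thesis
      by simp
  qed
  ultimately show ?thesis
    unfolding reducible_def using sub by (intro exI[of _ f]) auto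
qed

text \<open>The index map \<open>\<gamma>\<close> is generalized because the induction passes to
  rows of the code while the point \<open>x\<close> stays the same.\<close>

lemma reducible_diagonal: "reducible (Suc (Suc n)) {x. x \<in> usig n (\<lambda>j. x (\<gamma> j))}"
proof (induction n arbitrary: \<gamma>)
  case 0
  have "{x. x \<in> usig 0 (\<lambda>j. x (\<gamma> j))} = (\<Union>k. {x. x (\<gamma> k)} \<inter> cyl k)"
    by auto
  moreover have "reducible (Suc 0) ({x. x (\<gamma> k)} \<inter> cyl k)" for k
    by (rule reducible_clopen)
      (auto simp: Compl_Int open_Un open_Int open_coord clopen_cyl Collect_neg_eq[symmetric]
        open_not_coord)
  ultimately show ?case
    by (simp only: reducible_Union)
next
  case (Suc n)
  have "{x. x \<in> usig (Suc n) (\<lambda>j. x (\<gamma> j))} =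
      (\<Union>k. - {x. x \<in> usig n (\<lambda>j. x (\<gamma> (prod_encode (k, j))))})"
    by auto
  moreover have "reducible (Suc (Suc n)) (- {x. x \<in> usig n (\<lambda>j. x (\<gamma> (prod_encode (k, j))))})" for k
    by (rule reducible_Compl) (rule Suc.IH)
  ultimately show ?case
    by (simp only: reducible_Union)
qed

text \<open>A set \<open>E\<close> of indices is turned into the union of the blocks
  \<open>X s\<close> with \<open>s \<in> E\<close>. This carries the reduction of \<open>D\<close>
  over to subsets of \<open>\<omega>\<close>, so a separating set would pull back to
  \<open>D\<close>.\<close>

lemma Fin_part_not_separated:
  assumes X: "partition_into_infinite (seqs (Suc n + 1)) X"
    and \<S>: "\<S> \<in> Sigma0_fam (fin_ord (Suc n))" "Fin_part (Suc n) X \<subseteq> \<S>"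
  shows "dual_filter (Fin_part (Suc n) X) \<inter> \<S> \<noteq> {}"
proof
  assume disj: "dual_filter (Fin_part (Suc n) X) \<inter> \<S> = {}"
  let ?m = "Suc (Suc n)"
  define D where "D = - {x. x \<in> usig n x}"
  have "reducible ?m D"
    using reducible_Compl[OF reducible_diagonal[of n "\<lambda>j. j"]] by (simp add: D_def)
  then obtain f where f: "\<And>x. f x \<subseteq> seqs ?m" "\<And>s. open {x. s \<in> f x}" "\<And>s. open {x. s \<notin> f x}"
    "\<And>x. if x \<in> D then f x \<in> Fin_pow ?m else seqs ?m - f x \<in> Fin_pow ?m"
    unfolding reducible_def by blast
  define F where "F x z \<longleftrightarrow> cell X (Suc n) z \<in> f x" for x z
  have cont: "continuous_on UNIV F"
  proof (rule continuous_on_coordinatewise_then_product)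
    fix z
    have "open ((\<lambda>x. F x z) -` B)" for B
    proof -
      have "(\<lambda>x. F x z) -` B =
          (if True \<in> B then {x. cell X (Suc n) z \<in> f x} else {}) \<union>
          (if False \<in> B then {x. cell X (Suc n) z \<notin> f x} else {})" (is "?l = ?r")
      proof (rule set_eqI)
        show "x \<in> ?l \<longleftrightarrow> x \<in> ?r" for x
          by (cases "cell X (Suc n) z \<in> f x") (simp_all add: F_def)
      qed
      with f(2,3) show ?thesis
        by auto
    qed
    then show "continuous_on UNIV (\<lambda>x. F x z)"
      by (simp add: continuous_on_open_vimage)
  qed
  have inf: "infinite (X s)" if "s \<in> seqs ?m" for s
    using X that by (simp add: partition_into_infinite_def)
  have cell: "X s \<inter> {z. cell X (Suc n) z \<in> E} = (if s \<in> E then X s else {})"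
    if "s \<in> seqs ?m" for s E
    using cell_eqI[OF X] that by auto
  \<comment> \<open>A union of blocks meets each block in all of it or in nothing, so the indices of
    infinite intersection are exactly \<open>E\<close>.\<close>
  have part: "{z. cell X (Suc n) z \<in> E} \<in> Fin_part (Suc n) X" if "E \<in> Fin_pow ?m" for E
  proof -
    have "E \<subseteq> seqs ?m"
      using that by (simp only: Fin_pow_Suc_iff)
    then have "{s \<in> seqs ?m. infinite ({z. cell X (Suc n) z \<in> E} \<inter> X s)} = E"
      using cell inf by (auto simp: Int_commute split: if_splits)
    with that show ?thesis
      by (simp add: Fin_part_def del: Fin_pow.simps)
  qed
  have "{z. F x z} \<in> \<S> \<longleftrightarrow> x \<in> D" for x
  proof (cases "x \<in> D")
    case True
    then have "{z. F x z} \<in> Fin_part (Suc n) X"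
      using f(4)[of x] part[of "f x"] unfolding F_def by simp
    with True \<S>(2) show ?thesis
      by blast
  next
    case False
    then have "{z. cell X (Suc n) z \<in> seqs ?m - f x} \<in> Fin_part (Suc n) X"
      using f(4)[of x] by (intro part) simp
    also have "{z. cell X (Suc n) z \<in> seqs ?m - f x} = - {z. F x z}"
      using cell_in_seqs[OF X] by (auto simp: F_def)
    finally have "{z. F x z} \<in> dual_filter (Fin_part (Suc n) X)"
      unfolding dual_filter_def by blast
    with False disj show ?thesis
      by blast
  qed
  then have "F -` (\<lambda>A n. n \<in> A) ` \<S> = D"
    unfolding image_charfun by auto
  moreover have "Sigma0 (fin_ord (Suc n)) (F -` (\<lambda>A n. n \<in> A) ` \<S>)"
    using \<S>(1) cont by (intro Sigma0_vimage) (simp_all add: Sigma0_fam_def)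
  ultimately have "D \<in> range (usig n)"
    by (metis Sigma0_in_range_usig)
  then obtain c where "D = usig n c"
    by (rule rangeE)
  \<comment> \<open>Cantor's diagonal argument: the code \<open>c\<close> is evaluated at
    itself.\<close>
  then have "c \<in> D \<longleftrightarrow> c \<in> usig n c"
    by simp
  then show False
    by (auto simp: D_def)
qed

theorem theorem4p5:
  fixes X :: "nat list \<Rightarrow> nat set"
  assumes "\<And>n. partition_into_infinite (seqs (n + 1)) X"
    and "\<And>(F :: nat set) (s :: nat \<Rightarrow> nat list).
           finite F \<Longrightarrow> (\<And>i. i \<in> F \<Longrightarrow> s i \<in> seqs (i + 1)) \<Longrightarrow> infinite (\<Inter>i\<in>F. X (s i))"
  shows "ideal_on_nat (Fin'_omega X) \<and> Fin'_omega X \<in> Sigma0_fam omega \<and> rk (Fin'_omega X) = omega"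
proof (intro conjI)
  show ideal: "ideal_on_nat (Fin'_omega X)"
    using assms by (rule ideal_Fin'_omega)
  show Sigma: "Fin'_omega X \<in> Sigma0_fam omega"
    using assms(1) by (rule Fin'_omega_Sigma0_omega)
  \<comment> \<open>The ideal itself will be the separating set at level
    \<open>omega\<close>.\<close>
  have "A \<notin> dual_filter (Fin'_omega X)" if "A \<in> Fin'_omega X" for A
  proof
    assume "A \<in> dual_filter (Fin'_omega X)"
    then have "- A \<in> Fin'_omega X"
      by (auto simp: dual_filter_def)
    with that ideal have "A \<union> - A \<in> Fin'_omega X"
      unfolding ideal_on_nat_def by blast
    with ideal show False
      by (simp add: ideal_on_nat_def)
  qed
  then have disj: "dual_filter (Fin'_omega X) \<inter> Fin'_omega X = {}"
    by blast
  show "rk (Fin'_omega X) = omega"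
    unfolding rk_def
  proof (rule Least_equality)
    show "\<exists>\<S>\<in>Sigma0_fam (1 + omega). Fin'_omega X \<subseteq> \<S> \<and> dual_filter (Fin'_omega X) \<inter> \<S> = {}"
      using Sigma disj by (auto simp: one_plus_omega)
  next
    fix \<alpha>
    assume "\<exists>\<S>\<in>Sigma0_fam (1 + \<alpha>). Fin'_omega X \<subseteq> \<S> \<and> dual_filter (Fin'_omega X) \<inter> \<S> = {}"
    then obtain \<S> where \<S>: "\<S> \<in> Sigma0_fam (1 + \<alpha>)" "Fin'_omega X \<subseteq> \<S>"
        "dual_filter (Fin'_omega X) \<inter> \<S> = {}"
      by blast
    show "omega \<le> \<alpha>"
    proof (rule ccontr)
      assume "\<not> omega \<le> \<alpha>"
      then obtain n where n: "\<alpha> = fin_ord n"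
        using less_omegaE not_le by metis
      \<comment> \<open>A set separating the whole ideal from its dual filter also separates this
        smaller family from its own.\<close>
      have "Fin_part (Suc n) X \<subseteq> Fin'_omega X"
      proof
        fix A assume "A \<in> Fin_part (Suc n) X"
        then show "A \<in> Fin'_omega X"
          unfolding Fin'_omega_def by (intro CollectI exI[of _ "{A}"]) auto
      qed
      moreover from this have "dual_filter (Fin_part (Suc n) X) \<subseteq> dual_filter (Fin'_omega X)"
        by (auto simp: dual_filter_def)
      ultimately show False
        using Fin_part_not_separated[of n X \<S>] assms(1)[of "Suc n"] \<S>
        unfolding n one_plus_fin_ord by blast
    qed
  qed
qed

end
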